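(* Let $\alpha\in(0,1)$, $\sigma>0$, $\beta\in[-1,1]$, let $C_+=\sigma^\alpha(1-i\beta\tan(\alpha\pi/2))$ and $\varphi_0=\arg C_+=-\arctan(\beta\tan(\alpha\pi/2))$, and let $F$ be the corresponding stable cumulative distribution function. Let $x'\in\mathbb{R}\setminus\{0\}$ satisfy $|x'|+|C_+|\cos\left(\varphi_0-(\operatorname{sign} x')\frac{\alpha\pi}{2}\right)>0$. Then, for $\pm x'>0$ (upper signs throughout if $x'>0$, lower signs throughout if $x'<0$), $$F(x')=\frac{1\pm1}{2}+\frac1\pi\int_{\mathbb{R}} e^{-|x'|e^{y}-|C_+|\cos(\varphi_0\mp\frac{\alpha\pi}{2})e^{\alpha y}}\,\sin\left(|C_+|\sin\left(\varphi_0\mp\tfrac{\alpha\pi}{2}\right)e^{\alpha y}\right)dy.$$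
   Context: The stable cumulative distribution function (centered, index $\alpha\in(0,1)$, scale $\sigma$, asymmetry $\beta$) is $$F(x')=\frac12+\mathrm{v.p.}\,\frac{1}{2\pi}\int_{\mathbb{R}}\frac{e^{-ix'\xi-\psi^0_{st}(\xi)}}{-i\xi}\,d\xi,$$ where v.p. denotes the Cauchy principal value and $\psi^0_{st}(\xi)=\sigma^\alpha(1-i\beta\tan(\alpha\pi/2)\operatorname{sign}\xi)|\xi|^\alpha$, that is, $\psi^0_{st}(\xi)=C_+|\xi|^\alpha$ for $\xi>0$ and $\psi^0_{st}(\xi)=\overline{C_+}|\xi|^\alpha$ for $\xi<0$. Here $x'=x-\mu$, where $\mu$ is the location parameter. *)

theory Defs
  imports "HOL-Analysis.Analysis"
begin

text \<open>Cauchy principal value of an integral over the line with a singularity at the origin,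
  in the case where the integrand is Lebesgue integrable away from the origin.\<close>

definition pv_integrable :: "(real \<Rightarrow> complex) \<Rightarrow> bool" where
  "pv_integrable f \<longleftrightarrow>
     (\<forall>\<epsilon>>0. set_integrable lborel {\<xi>. \<bar>\<xi>\<bar> > \<epsilon>} f) \<and>
     (\<exists>l. ((\<lambda>\<epsilon>. set_lebesgue_integral lborel {\<xi>. \<bar>\<xi>\<bar> > \<epsilon>} f) \<longlongrightarrow> l) (at_right 0))"

definition pv_integral :: "(real \<Rightarrow> complex) \<Rightarrow> complex" where
  "pv_integral f = Lim (at_right 0) (\<lambda>\<epsilon>. set_lebesgue_integral lborel {\<xi>. \<bar>\<xi>\<bar> > \<epsilon>} f)"

definition stable_C :: "real \<Rightarrow> real \<Rightarrow> real \<Rightarrow> complex" where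
  "stable_C \<alpha> \<sigma> \<beta> =
     of_real (\<sigma> powr \<alpha>) * (1 - \<i> * of_real \<beta> * of_real (tan (\<alpha> * pi / 2)))"

definition stable_psi :: "real \<Rightarrow> real \<Rightarrow> real \<Rightarrow> real \<Rightarrow> complex" where
  "stable_psi \<alpha> \<sigma> \<beta> \<xi> =
     of_real (\<sigma> powr \<alpha>) * (1 - \<i> * of_real \<beta> * of_real (tan (\<alpha> * pi / 2)) * of_real (sgn \<xi>))
       * of_real (\<bar>\<xi>\<bar> powr \<alpha>)"

definition stable_integrand :: "real \<Rightarrow> real \<Rightarrow> real \<Rightarrow> real \<Rightarrow> real \<Rightarrow> complex" where
  "stable_integrand \<alpha> \<sigma> \<beta> x' \<xi> =
     exp (- \<i> * of_real x' * of_real \<xi> - stable_psi \<alpha> \<sigma> \<beta> \<xi>) / (- \<i> * of_real \<xi>)"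

text \<open>The variable \<open>x'\<close> is centered: it stands for \<open>x - \<mu>\<close> with \<open>\<mu>\<close> the location parameter.
  The function is complex-valued because the defining formula is; that its values are real is
  not built into the definition.\<close>

definition stable_cdf :: "real \<Rightarrow> real \<Rightarrow> real \<Rightarrow> real \<Rightarrow> complex" where
  "stable_cdf \<alpha> \<sigma> \<beta> x' = 1 / 2 + 1 / (2 * of_real pi) * pv_integral (stable_integrand \<alpha> \<sigma> \<beta> x')"

lemma stable_psi_pos:
  "\<xi> > 0 \<Longrightarrow> stable_psi \<alpha> \<sigma> \<beta> \<xi> = stable_C \<alpha> \<sigma> \<beta> * of_real (\<bar>\<xi>\<bar> powr \<alpha>)"
  by (simp add: stable_psi_def stable_C_def)

lemma stable_psi_neg:
  "\<xi> < 0 \<Longrightarrow> stable_psi \<alpha> \<sigma> \<beta> \<xi> = cnj (stable_C \<alpha> \<sigma> \<beta>) * of_real (\<bar>\<xi>\<bar> powr \<alpha>)"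
  by (simp add: stable_psi_def stable_C_def)

lemma Arg_stable_C:
  assumes "\<sigma> > 0"
  shows "Arg (stable_C \<alpha> \<sigma> \<beta>) = - arctan (\<beta> * tan (\<alpha> * pi / 2))"
  using assms by (simp add: stable_C_def arg_conv_arctan arctan_minus)

end

theory Submission
  imports Defs "HOL-Complex_Analysis.Cauchy_Integral_Theorem"
begin

text \<open>The integrand is Hermitian in \<open>\<xi>\<close>, so the principal value is twice the real part of a
  half-line integral. Substituting \<open>\<xi> = exp z\<close> turns \<open>d\<xi> / \<xi>\<close> into \<open>dz\<close> and the exponential into
  an entire function of \<open>z\<close>, which has an entire primitive \<open>G\<close>. Rotating the half-line by
  \<open>- sgn x * pi / 2\<close> is then a comparison of \<open>G\<close> on the lines \<open>Im z = 0\<close> and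
  \<open>Im z = - sgn x * pi / 2\<close>: the two values of \<open>G\<close> merge as \<open>Re z\<close> tends to \<open>+\<infinity>\<close>, and as
  \<open>Re z\<close> tends to \<open>-\<infinity>\<close> the integrand tends to \<open>1\<close>, so that their difference tends to
  \<open>- \<i> * sgn x * pi / 2\<close>, which produces the jump term.\<close>

section \<open>Half-line calculus and an estimate for \<open>exp\<close>\<close>

text \<open>Serves in two directions: it yields the limit of the primitive on the rotated line from
  integrability of the kernel there, and it identifies the half-line integral of
  \<open>half_integrand\<close> once the limit of its primitive is known.\<close>

lemma FTC_tendsto_at_top:
  fixes F f :: "real \<Rightarrow> 'a::euclidean_space"
  assumes F: "\<And>x. a \<le> x \<Longrightarrow> (F has_vector_derivative f x) (at x)"
    and cont: "continuous_on {a..} f"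
    and int: "set_integrable lborel {a<..} f"
  shows "(F \<longlongrightarrow> F a + set_lebesgue_integral lborel {a<..} f) at_top"
proof -
  \<comment> \<open>Adding the endpoint changes neither integrability nor the integral;
    \<open>tendsto_set_lebesgue_integral_at_top\<close> works on closed half-lines.\<close>
  have ae: "AE x in lborel. x \<in> {a<..} \<longleftrightarrow> x \<in> {a..}"
    using AE_lborel_singleton[of a] by eventually_elim auto
  have meas: "set_borel_measurable lborel {a..} f"
    using cont by (auto simp: set_borel_measurable_def intro!: borel_measurable_continuous_on_indicator)
  have int': "set_integrable lborel {a..} f"
  proof -
    have "{a..} = {a<..} \<union> {a..a}" by auto
    then show ?thesis
      using set_integrable_Un[OF int borel_integrable_atLeastAtMost'[of a a f]] by simp
  qed
  have eq: "set_lebesgue_integral lborel {a<..} f = set_lebesgue_integral lborel {a..} f"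
    using ae meas int by (intro set_integral_cong_set) (auto simp: set_borel_measurable_def set_integrable_def)
  have "((\<lambda>b. F a + set_lebesgue_integral lborel {a..b} f) \<longlongrightarrow>
         F a + set_lebesgue_integral lborel {a..} f) at_top"
    by (intro tendsto_intros tendsto_set_lebesgue_integral_at_top int') auto
  moreover have "\<forall>\<^sub>F b in at_top. F a + set_lebesgue_integral lborel {a..b} f = F b"
    using eventually_ge_at_top[of a]
  proof eventually_elim
    case (elim b)
    have "set_lebesgue_integral lborel {a..b} f = F b - F a"
      unfolding set_lebesgue_integral_def
      by (rule integral_FTC_atLeastAtMost)
        (use elim F cont in \<open>auto intro: has_vector_derivative_at_within continuous_on_subset\<close>)
    then show ?case by simp
  qed
  ultimately show ?thesis
    unfolding eq by (rule Lim_transform_eventually)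
qed

text \<open>Majorant for \<open>half_integrand\<close>: the decay of the kernel on the real line,
  divided by \<open>\<xi>\<close>.\<close>

lemma set_integrable_powr_Ioi:
  fixes \<epsilon> p :: real
  assumes "\<epsilon> > 0" "p > 0"
  shows "set_integrable lborel {\<epsilon><..} (\<lambda>\<xi>. \<xi> powr (- p - 1))"
proof -
  have "set_integrable lborel (einterval (ereal \<epsilon>) \<infinity>) (\<lambda>\<xi>. \<xi> powr (- p - 1))"
  proof (rule interval_integral_FTC_nonneg)
    show "DERIV (\<lambda>\<xi>. - (\<xi> powr (- p)) / p) y :> y powr (- p - 1)"
      if "ereal \<epsilon> < ereal y" for y
      using that assms by (auto intro!: derivative_eq_intros)
    show "isCont (\<lambda>\<xi>. \<xi> powr (- p - 1)) y" if "ereal \<epsilon> < ereal y" for y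
      using that assms by (auto intro!: continuous_intros)
    show "(((\<lambda>\<xi>. - (\<xi> powr - p) / p) \<circ> real_of_ereal) \<longlongrightarrow> - (\<epsilon> powr - p) / p) (at_right (ereal \<epsilon>))"
      unfolding ereal_tendsto_simps using assms by (auto intro!: tendsto_eq_intros)
    have "((\<lambda>\<xi>::real. \<xi> powr - p) \<longlongrightarrow> 0) at_top"
      using assms by (intro tendsto_neg_powr filterlim_ident) auto
    from tendsto_divide[OF tendsto_minus[OF this] tendsto_const[of p]] assms
    show "(((\<lambda>\<xi>. - (\<xi> powr - p) / p) \<circ> real_of_ereal) \<longlongrightarrow> 0) (at_left \<infinity>)"
      unfolding ereal_tendsto_simps by simp
  qed (auto simp: assms)
  then show ?thesis by simp
qed

lemma set_integrable_exp_neg_Ioi: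
  fixes a p :: real
  assumes "p > 0"
  shows "set_integrable lborel {a<..} (\<lambda>y. exp (- p * y))"
proof -
  have "set_integrable lborel (einterval (ereal a) \<infinity>) (\<lambda>y. exp (- p * y))"
  proof (rule interval_integral_FTC_nonneg)
    show "DERIV (\<lambda>y. - exp (- p * y) / p) y :> exp (- p * y)" for y
      using assms by (auto intro!: derivative_eq_intros)
    show "(((\<lambda>y. - exp (- p * y) / p) \<circ> real_of_ereal) \<longlongrightarrow> - exp (- p * a) / p) (at_right (ereal a))"
      unfolding ereal_tendsto_simps using assms by (auto intro!: tendsto_eq_intros)
    have "((\<lambda>y. exp (- p * y)) \<longlongrightarrow> 0) at_top"
      using assms
      by (intro filterlim_compose[OF exp_at_bot] filterlim_tendsto_neg_mult_at_bot[OF tendsto_const])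
        (auto intro: filterlim_ident)
    from tendsto_divide[OF tendsto_minus[OF this] tendsto_const[of p]] assms
    show "(((\<lambda>y. - exp (- p * y) / p) \<circ> real_of_ereal) \<longlongrightarrow> 0) (at_left \<infinity>)"
      unfolding ereal_tendsto_simps by simp
  qed (auto intro!: continuous_intros)
  then show ?thesis by simp
qed

text \<open>Majorant on the whole line for the imaginary part of the kernel, which decays
  exponentially at both ends.\<close>

lemma integrable_exp_neg_abs:
  fixes p :: real
  assumes "p > 0"
  shows "integrable lborel (\<lambda>y. exp (- p * \<bar>y\<bar>))"
proof -
  have pos: "set_integrable lborel {0<..} (\<lambda>y. exp (- p * \<bar>y\<bar>))"
    using set_integrable_exp_neg_Ioi[OF assms, of 0]
    by (rule set_integrable_cong[THEN iffD1, rotated -1]) auto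
  have "set_integrable lborel {..<0} (\<lambda>y. exp (- p * \<bar>y\<bar>))"
    using lborel_integrable_real_affine[OF pos[unfolded set_integrable_def], of "-1" 0]
    unfolding set_integrable_def
    by (rule Bochner_Integration.integrable_cong[THEN iffD1, rotated -1]) (auto simp: indicator_def)
  from set_integrable_Un[OF this pos]
  have "set_integrable lborel ({..<0} \<union> {0<..}) (\<lambda>y. exp (- p * \<bar>y\<bar>))" by simp
  moreover have "AE y in lborel. indicator ({..<0} \<union> {0<..}) y *\<^sub>R exp (- p * \<bar>y\<bar>) = exp (- p * \<bar>y\<bar>)"
    using AE_lborel_singleton[of "0::real"] by eventually_elim (auto simp: indicator_def)
  ultimately show ?thesis
    unfolding set_integrable_def by (subst (asm) integrable_cong_AE) auto
qed

text \<open>Dominated convergence along an arbitrary sequence tending to \<open>at_bot\<close>: at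
  each point the indicators are eventually 1.\<close>

lemma tendsto_set_integral_Ioi_at_bot:
  fixes f :: "real \<Rightarrow> 'a::{banach, second_countable_topology}"
  assumes f: "integrable lborel f"
  shows "((\<lambda>a. set_lebesgue_integral lborel {a<..} f) \<longlongrightarrow> (LINT y|lborel. f y)) at_bot"
proof (rule tendsto_at_botI_sequentially)
  fix X :: "nat \<Rightarrow> real" assume X: "filterlim X at_bot sequentially"
  show "(\<lambda>n. set_lebesgue_integral lborel {X n<..} f) \<longlonglongrightarrow> (LINT y|lborel. f y)"
    unfolding set_lebesgue_integral_def
  proof (rule integral_dominated_convergence[where w = "\<lambda>y. norm (f y)"])
    show "AE y in lborel. (\<lambda>n. indicat_real {X n<..} y *\<^sub>R f y) \<longlonglongrightarrow> f y"
    proof (rule AE_I2)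
      fix y
      have "\<forall>\<^sub>F n in sequentially. X n < y"
        using X by (simp add: filterlim_at_bot_dense)
      then have "\<forall>\<^sub>F n in sequentially. indicat_real {X n<..} y *\<^sub>R f y = f y"
        by eventually_elim auto
      then show "(\<lambda>n. indicat_real {X n<..} y *\<^sub>R f y) \<longlonglongrightarrow> f y"
        by (rule tendsto_eventually)
    qed
  qed (use f in \<open>auto simp: indicator_def borel_measurable_integrable intro!: borel_measurable_scaleR\<close>)
qed

text \<open>Mean value inequality on the disc of radius \<open>norm w\<close>, where the derivative
  of \<open>exp\<close> is at most \<open>exp (norm w)\<close>.\<close>

lemma norm_exp_minus_one_le:
  fixes w :: complex
  shows "norm (exp w - 1) \<le> norm w * exp (norm w)"
proof -
  have "norm (exp w - exp 0) \<le> exp (norm w) * norm (w - 0)"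
  proof (rule field_differentiable_bound[where S = "cball 0 (norm w)"])
    fix z :: complex assume "z \<in> cball 0 (norm w)"
    then show "norm (exp z) \<le> exp (norm w)"
      using norm_exp[of z] order_trans by fastforce
  qed (auto intro!: derivative_eq_intros)
  then show ?thesis by (simp add: mult.commute)
qed


section \<open>The kernel on rotated rays\<close>

text \<open>Scale and asymmetry enter only through \<open>C\<close>. Positivity of
  \<open>Re C\<close> makes the kernel decay on the real line.\<close>

locale rotated_stable_kernel =
  fixes \<alpha> x :: real and C :: complex
  assumes \<alpha>: "0 < \<alpha>" "\<alpha> < 1" and x: "x \<noteq> 0" and C: "Re C > 0"
begin

definition kernel :: "complex \<Rightarrow> complex" where
  "kernel z = exp (- \<i> * of_real x * exp z - C * exp (of_real \<alpha> * z))"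

text \<open>The map \<open>exp\<close> sends this horizontal line to the ray of argument
  \<open>- sgn x * \<tau>\<close>. With this sign, \<open>- \<i> * x * \<xi>\<close> has real part
  \<open>- \<bar>x\<bar> * \<bar>\<xi>\<bar> * sin \<tau>\<close> there, so rotating turns
  oscillation into damping.\<close>

definition ray :: "real \<Rightarrow> real \<Rightarrow> complex" where
  "ray \<tau> y = Complex y (- sgn x * \<tau>)"

lemma ray_0: "ray 0 y = of_real y"
  by (simp add: ray_def complex_eq_iff)

lemma kernel_exponent_ray:
  "- \<i> * of_real x * exp (ray \<tau> y) = - (of_real (\<bar>x\<bar> * exp y) * (of_real (sin \<tau>) + \<i> * of_real (sgn x * cos \<tau>)))"
  "exp (of_real \<alpha> * ray \<tau> y) = of_real (exp (\<alpha> * y)) * cis (- sgn x * (\<alpha> * \<tau>))"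
  using x by (cases "x > 0"; auto simp: ray_def complex_eq_iff Re_exp Im_exp algebra_simps)+

lemma norm_kernel_ray:
  "norm (kernel (ray \<tau> y)) = exp (- \<bar>x\<bar> * exp y * sin \<tau>
     - (Re C * cos (\<alpha> * \<tau>) + sgn x * Im C * sin (\<alpha> * \<tau>)) * exp (\<alpha> * y))"
  unfolding kernel_def norm_exp_eq_Re kernel_exponent_ray
  using x by (cases "x > 0"; simp add: algebra_simps)

text \<open>The coefficient of \<open>exp (\<alpha> * y)\<close> in the exponent may be negative, but it is at least
  \<open>Re C * cos (\<alpha> * pi / 2) - norm C * sin \<tau>\<close>; since \<open>\<alpha> < 1\<close>, the term \<open>\<bar>x\<bar> * exp y * sin \<tau>\<close>
  absorbs the deficit up to a constant, uniformly in \<open>\<tau>\<close>.\<close>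

lemma kernel_ray_decay:
  obtains M where "M \<ge> 0" "\<And>y \<tau>. 0 \<le> \<tau> \<Longrightarrow> \<tau> \<le> pi / 2 \<Longrightarrow> norm (kernel (ray \<tau> y)) \<le> M * exp (- \<alpha> * y)"
proof -
  define c where "c = Re C * cos (\<alpha> * (pi / 2))"
  have ap: "\<alpha> * (pi / 2) < pi / 2" "0 < \<alpha> * (pi / 2)"
    using \<alpha> by auto
  \<comment> \<open>Since \<alpha> < 1, the angle \<open>\<alpha> * (pi / 2)\<close> stays strictly
    below a right angle.\<close>
  have c: "c > 0"
    unfolding c_def using ap C by (intro mult_pos_pos cos_gt_zero_pi) linarith+
  \<comment> \<open>\<open>R\<close> is the point of balance:
    \<open>norm C * exp (\<alpha> * R) = \<bar>x\<bar> * exp R\<close>. To its right the linear term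
    dominates, to its left \<open>norm C * exp (\<alpha> * y)\<close> is at most
    \<open>B\<close>.\<close>
  define R where "R = ln (norm C / \<bar>x\<bar>) / (1 - \<alpha>)"
  define B where "B = norm C * exp (\<alpha> * R)"
  have B: "B \<ge> 0" by (simp add: B_def)
  have nC: "norm C > 0" using C by auto
  have absorb: "norm C * exp (\<alpha> * y) - \<bar>x\<bar> * exp y \<le> B" for y
  proof (cases "y \<le> R")
    case True
    then have "norm C * exp (\<alpha> * y) \<le> B"
      unfolding B_def using \<alpha> by (intro mult_left_mono) auto
    moreover have "0 \<le> \<bar>x\<bar> * exp y" by simp
    ultimately show ?thesis by linarith
  next
    case False
    then have "ln (norm C / \<bar>x\<bar>) \<le> (1 - \<alpha>) * y"
      using \<alpha> by (simp add: R_def field_simps)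
    then have "norm C / \<bar>x\<bar> \<le> exp ((1 - \<alpha>) * y)"
      using nC x by (metis divide_pos_pos exp_le_cancel_iff exp_ln zero_less_abs_iff)
    then have "norm C * exp (\<alpha> * y) \<le> \<bar>x\<bar> * exp ((1 - \<alpha>) * y) * exp (\<alpha> * y)"
      using x by (intro mult_right_mono) (auto simp: field_simps)
    also have "\<dots> = \<bar>x\<bar> * exp y"
      by (simp add: mult.assoc flip: exp_add) (simp add: algebra_simps)
    finally show ?thesis using B by linarith
  qed
  show thesis
  proof
    show "exp B / c \<ge> 0" using c by simp
    fix y \<tau> :: real assume \<tau>: "0 \<le> \<tau>" "\<tau> \<le> pi / 2"
    have at: "0 \<le> \<alpha> * \<tau>" "\<alpha> * \<tau> \<le> \<alpha> * (pi / 2)" "\<alpha> * \<tau> \<le> \<tau>"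
      using \<alpha> \<tau> by (auto intro: mult_left_mono mult_left_le_one_le)
    \<comment> \<open>Passing from \<open>sin (\<alpha> * \<tau>)\<close> to
      \<open>sin \<tau>\<close> gives the deficit the same factor as the damping term, so that
      \<open>absorb\<close> applies to their sum for every angle at once.\<close>
    have sin: "0 \<le> sin (\<alpha> * \<tau>)" "sin (\<alpha> * \<tau>) \<le> sin \<tau>" "sin \<tau> \<le> 1"
      using at \<tau> by (auto intro!: sin_ge_zero sin_monotone_2pi_le)
    have "c \<le> Re C * cos (\<alpha> * \<tau>)"
      unfolding c_def using at(1,2) ap C by (intro mult_left_mono[OF cos_monotone_0_pi_le]) linarith+
    moreover have "sgn x * Im C * sin (\<alpha> * \<tau>) \<ge> - norm C * sin \<tau>"
    proof -
      have "\<bar>sgn x * Im C\<bar> * sin (\<alpha> * \<tau>) \<le> norm C * sin \<tau>"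
        using sin x abs_Im_le_cmod[of C] by (intro mult_mono) (auto simp: abs_mult abs_sgn_eq)
      moreover have "- (\<bar>sgn x * Im C\<bar> * sin (\<alpha> * \<tau>)) \<le> sgn x * Im C * sin (\<alpha> * \<tau>)"
        using sin(1) by (metis abs_ge_minus_self abs_mult abs_of_nonneg minus_le_iff)
      ultimately show ?thesis by simp
    qed
    ultimately have "c - norm C * sin \<tau> \<le> Re C * cos (\<alpha> * \<tau>) + sgn x * Im C * sin (\<alpha> * \<tau>)" by simp
    then have "(c - norm C * sin \<tau>) * exp (\<alpha> * y)
        \<le> (Re C * cos (\<alpha> * \<tau>) + sgn x * Im C * sin (\<alpha> * \<tau>)) * exp (\<alpha> * y)"
      by (intro mult_right_mono) auto
    then have "norm (kernel (ray \<tau> y)) \<le> exp (sin \<tau> * (norm C * exp (\<alpha> * y) - \<bar>x\<bar> * exp y) - c * exp (\<alpha> * y))"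
      unfolding norm_kernel_ray by (simp add: algebra_simps)
    also have "sin \<tau> * (norm C * exp (\<alpha> * y) - \<bar>x\<bar> * exp y) \<le> B"
    proof -
      have "sin \<tau> * (norm C * exp (\<alpha> * y) - \<bar>x\<bar> * exp y) \<le> sin \<tau> * B"
        using absorb sin by (intro mult_left_mono) auto
      also have "\<dots> \<le> B" using sin B by (intro mult_left_le_one_le) auto
      finally show ?thesis .
    qed
    then have "exp (sin \<tau> * (norm C * exp (\<alpha> * y) - \<bar>x\<bar> * exp y) - c * exp (\<alpha> * y)) \<le> exp B / exp (c * exp (\<alpha> * y))"
      by (simp flip: exp_diff)
    \<comment> \<open>The doubly exponential decay is weakened through \<open>t \<le> exp t\<close>;
      a simple exponential is all that the integrability proofs require.\<close>
    also have "\<dots> \<le> exp B / (c * exp (\<alpha> * y))"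
      using c exp_ge_add_one_self[of "c * exp (\<alpha> * y)"]
      by (intro divide_left_mono) (auto simp del: exp_ge_add_one_self)
    also have "\<dots> = exp B / c * exp (- \<alpha> * y)" by (simp add: exp_minus field_simps)
    finally show "norm (kernel (ray \<tau> y)) \<le> exp B / c * exp (- \<alpha> * y)" .
  qed
qed

text \<open>Rotation preserves moduli, and \<open>exp y \<le> exp (\<alpha> * y)\<close> for
  \<open>y \<le> 0\<close>, so the exponent is of order \<open>exp (\<alpha> * y)\<close> uniformly
  in the angle.\<close>

lemma kernel_near_one:
  obtains N where "N \<ge> 0" "\<And>y \<tau>. y \<le> 0 \<Longrightarrow> norm (kernel (ray \<tau> y) - 1) \<le> N * exp (\<alpha> * y)"
proof
  define K where "K = \<bar>x\<bar> + norm C"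
  show "K * exp K \<ge> 0" by (simp add: K_def)
  fix y \<tau> :: real assume y: "y \<le> 0"
  define w where "w = - \<i> * of_real x * exp (ray \<tau> y) - C * exp (of_real \<alpha> * ray \<tau> y)"
  have "norm w \<le> \<bar>x\<bar> * exp y + norm C * exp (\<alpha> * y)"
    unfolding w_def using norm_triangle_ineq4[of "- \<i> * of_real x * exp (ray \<tau> y)" "C * exp (of_real \<alpha> * ray \<tau> y)"]
    by (simp add: norm_mult ray_def)
  also have "\<dots> \<le> \<bar>x\<bar> * exp (\<alpha> * y) + norm C * exp (\<alpha> * y)"
    using y \<alpha> mult_right_mono_neg[of \<alpha> 1 y] by (intro add_right_mono mult_left_mono) auto
  finally have w: "norm w \<le> K * exp (\<alpha> * y)" by (simp add: K_def algebra_simps)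
  also have "\<dots> \<le> K" using y \<alpha> by (intro mult_left_le) (auto simp: K_def mult_nonneg_nonpos)
  finally have wK: "norm w \<le> K" .
  have "norm (exp w - 1) \<le> norm w * exp (norm w)" by (rule norm_exp_minus_one_le)
  also have "\<dots> \<le> (K * exp (\<alpha> * y)) * exp K" using w wK by (intro mult_mono) (auto simp: K_def)
  finally show "norm (kernel (ray \<tau> y) - 1) \<le> K * exp K * exp (\<alpha> * y)"
    by (simp add: kernel_def w_def algebra_simps)
qed

text \<open>The vertical segment joining the two lines runs through the intermediate rays, so
  estimates uniform in \<open>\<tau>\<close> hold along it.\<close>

lemma closed_segment_rays:
  assumes "z \<in> closed_segment (ray 0 y) (ray (pi / 2) y)"
  obtains \<tau> where "0 \<le> \<tau>" "\<tau> \<le> pi / 2" "z = ray \<tau> y"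
proof -
  obtain u where u: "0 \<le> u" "u \<le> 1" "z = (1 - u) *\<^sub>R ray 0 y + u *\<^sub>R ray (pi / 2) y"
    using assms by (auto simp: in_segment)
  show thesis
  proof
    show "z = ray (u * (pi / 2)) y" using u by (simp add: ray_def complex_eq_iff algebra_simps)
    show "u * (pi / 2) \<le> pi / 2" using u by (intro mult_left_le_one_le) auto
  qed (use u in auto)
qed

section \<open>The primitive on the two boundary lines\<close>

lemma kernel_primitive:
  obtains G where "\<And>z. (G has_field_derivative kernel z) (at z)"
proof -
  have "kernel holomorphic_on UNIV"
    unfolding kernel_def by (intro holomorphic_intros)
  then show thesis
    using holomorphic_convex_primitive'[of UNIV kernel] that by auto
qed

context
  fixes G assumes G: "\<And>z. (G has_field_derivative kernel z) (at z)"
begin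

lemma primitive_ray_has_vector_derivative:
  "((\<lambda>y. G (ray \<tau> y)) has_vector_derivative kernel (ray \<tau> y)) (at y)"
proof -
  have ray: "ray \<tau> = (\<lambda>y. of_real y + \<i> * of_real (- sgn x * \<tau>))"
    by (auto simp: ray_def complex_eq_iff)
  have "(ray \<tau> has_vector_derivative 1) (at y)"
    unfolding ray by (auto intro!: derivative_eq_intros)
  from field_vector_diff_chain_at[OF this G] show ?thesis by (simp add: o_def)
qed

text \<open>Mean value inequality on the vertical segment, whose length is always
  \<open>pi / 2\<close> while the kernel on it decays.\<close>

lemma primitive_rays_at_top:
  "((\<lambda>y. G (ray (pi / 2) y) - G (ray 0 y)) \<longlongrightarrow> 0) at_top"
proof -
  obtain M where M: "\<And>y \<tau>. 0 \<le> \<tau> \<Longrightarrow> \<tau> \<le> pi / 2 \<Longrightarrow> norm (kernel (ray \<tau> y)) \<le> M * exp (- \<alpha> * y)"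
    using kernel_ray_decay by blast
  have "norm (G (ray (pi / 2) y) - G (ray 0 y)) \<le> M * exp (- \<alpha> * y) * norm (ray (pi / 2) y - ray 0 y)" for y
    using M by (intro field_differentiable_bound[where S = "closed_segment (ray 0 y) (ray (pi / 2) y)"])
      (auto intro: has_field_derivative_at_within G elim: closed_segment_rays)
  moreover have "norm (ray (pi / 2) y - ray 0 y) = pi / 2" for y
    using x by (auto simp: ray_def norm_complex_def sgn_if cmod_def)
  ultimately have bd: "norm (G (ray (pi / 2) y) - G (ray 0 y)) \<le> M * exp (- \<alpha> * y) * (pi / 2)" for y
    by metis
  have "((\<lambda>y. exp (- \<alpha> * y)) \<longlongrightarrow> 0) at_top"
    using \<alpha> by (intro filterlim_compose[OF exp_at_bot] filterlim_tendsto_neg_mult_at_bot[OF tendsto_const])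
      (auto intro: filterlim_ident)
  then have "((\<lambda>y. M * exp (- \<alpha> * y) * (pi / 2)) \<longlongrightarrow> 0) at_top"
    by (intro tendsto_mult_left_zero tendsto_mult_right_zero)
  then show ?thesis
    by (rule Lim_null_comparison[rotated]) (use bd in auto)
qed

text \<open>Mean value inequality for \<open>G z - z\<close>, whose derivative
  \<open>kernel z - 1\<close> vanishes in the limit. What survives is the displacement between the
  two lines, a constant.\<close>

lemma primitive_rays_at_bot:
  "((\<lambda>y. G (ray (pi / 2) y) - G (ray 0 y)) \<longlongrightarrow> - \<i> * of_real (sgn x * (pi / 2))) at_bot"
proof -
  obtain N where N: "\<And>y \<tau>. y \<le> 0 \<Longrightarrow> norm (kernel (ray \<tau> y) - 1) \<le> N * exp (\<alpha> * y)"
    using kernel_near_one by blast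
  have diff: "ray (pi / 2) y - ray 0 y = - \<i> * of_real (sgn x * (pi / 2))" for y
    by (simp add: ray_def complex_eq_iff)
  have bd: "norm (G (ray (pi / 2) y) - G (ray 0 y) - (- \<i> * of_real (sgn x * (pi / 2)))) \<le> N * exp (\<alpha> * y) * (pi / 2)"
    if "y \<le> 0" for y
  proof -
    have "norm ((G (ray (pi / 2) y) - ray (pi / 2) y) - (G (ray 0 y) - ray 0 y))
        \<le> N * exp (\<alpha> * y) * norm (ray (pi / 2) y - ray 0 y)"
      using N that by (intro field_differentiable_bound[where S = "closed_segment (ray 0 y) (ray (pi / 2) y)"
          and f = "\<lambda>z. G z - z" and f' = "\<lambda>z. kernel z - 1"])
        (auto intro!: derivative_intros has_field_derivative_at_within[OF G] elim: closed_segment_rays)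
    also have "norm (ray (pi / 2) y - ray 0 y) = pi / 2"
      unfolding diff using x by (simp add: norm_mult abs_mult abs_sgn_eq del: of_real_mult)
    also have "(G (ray (pi / 2) y) - ray (pi / 2) y) - (G (ray 0 y) - ray 0 y)
        = G (ray (pi / 2) y) - G (ray 0 y) - (ray (pi / 2) y - ray 0 y)"
      by simp
    finally show ?thesis unfolding diff .
  qed
  have "((\<lambda>y. exp (\<alpha> * y)) \<longlongrightarrow> 0) at_bot"
    using \<alpha> by (intro filterlim_compose[OF exp_at_bot] filterlim_tendsto_pos_mult_at_bot[OF tendsto_const])
      (auto intro: filterlim_ident)
  then have "((\<lambda>y. N * exp (\<alpha> * y) * (pi / 2)) \<longlongrightarrow> 0) at_bot"
    by (intro tendsto_mult_left_zero tendsto_mult_right_zero)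
  then have "((\<lambda>y. G (ray (pi / 2) y) - G (ray 0 y) - (- \<i> * of_real (sgn x * (pi / 2)))) \<longlongrightarrow> 0) at_bot"
    by (rule Lim_null_comparison[rotated])
      (use bd in \<open>auto intro: eventually_mono[OF eventually_le_at_bot[of 0]]\<close>)
  then show ?thesis by (rule LIM_zero_cancel)
qed

end

section \<open>Integrability along the rays and rotation of the half-line integral\<close>

lemma continuous_kernel_ray: "continuous_on S (\<lambda>y. kernel (ray \<tau> y))"
proof -
  have "ray \<tau> = (\<lambda>y. of_real y + \<i> * of_real (- sgn x * \<tau>))"
    by (auto simp: ray_def complex_eq_iff)
  then show ?thesis unfolding kernel_def by (auto intro!: continuous_intros)
qed

lemma set_integrable_kernel_ray:
  assumes "0 \<le> \<tau>" "\<tau> \<le> pi / 2"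
  shows "set_integrable lborel {a<..} (\<lambda>y. kernel (ray \<tau> y))"
proof -
  obtain M where M: "M \<ge> 0" "\<And>y \<tau>. 0 \<le> \<tau> \<Longrightarrow> \<tau> \<le> pi / 2 \<Longrightarrow> norm (kernel (ray \<tau> y)) \<le> M * exp (- \<alpha> * y)"
    using kernel_ray_decay by blast
  have "set_integrable lborel {a<..} (\<lambda>y. M * exp (- \<alpha> * y))"
    using set_integrable_exp_neg_Ioi[OF \<alpha>(1), of a] by (intro set_integrable_mult_right) auto
  then show ?thesis
  proof (rule set_integrable_bound)
    show "set_borel_measurable lborel {a<..} (\<lambda>y. kernel (ray \<tau> y))"
      unfolding set_borel_measurable_def
      by (auto intro!: borel_measurable_continuous_on_indicator continuous_kernel_ray)
  qed (use M assms in \<open>auto simp: abs_mult\<close>)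
qed

text \<open>The kernel tends to 1 at the left end and is not integrable on the whole line. Its
  imaginary part is also that of \<open>kernel - 1\<close>, which decays there.\<close>

lemma integrable_Im_kernel_ray:
  assumes "0 \<le> \<tau>" "\<tau> \<le> pi / 2"
  shows "integrable lborel (\<lambda>y. Im (kernel (ray \<tau> y)))"
proof -
  obtain M where M: "M \<ge> 0" "\<And>y \<tau>. 0 \<le> \<tau> \<Longrightarrow> \<tau> \<le> pi / 2 \<Longrightarrow> norm (kernel (ray \<tau> y)) \<le> M * exp (- \<alpha> * y)"
    using kernel_ray_decay by blast
  obtain N where N: "N \<ge> 0" "\<And>y \<tau>. y \<le> 0 \<Longrightarrow> norm (kernel (ray \<tau> y) - 1) \<le> N * exp (\<alpha> * y)"
    using kernel_near_one by blast
  have "integrable lborel (\<lambda>y. (M + N) * exp (- \<alpha> * \<bar>y\<bar>))"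
    using integrable_exp_neg_abs[OF \<alpha>(1)] by simp
  then show ?thesis
  proof (rule Bochner_Integration.integrable_bound)
    have "continuous_on UNIV (\<lambda>y. Im (kernel (ray \<tau> y)))"
      by (intro continuous_intros continuous_kernel_ray)
    then show "(\<lambda>y. Im (kernel (ray \<tau> y))) \<in> borel_measurable lborel"
      by (simp add: borel_measurable_continuous_onI)
    have "\<bar>Im (kernel (ray \<tau> y))\<bar> \<le> (M + N) * exp (- \<alpha> * \<bar>y\<bar>)" for y
    proof (cases "y \<le> 0")
      case True
      have "\<bar>Im (kernel (ray \<tau> y))\<bar> \<le> norm (kernel (ray \<tau> y) - 1)"
        using abs_Im_le_cmod[of "kernel (ray \<tau> y) - 1"] by simp
      also have "\<dots> \<le> N * exp (- \<alpha> * \<bar>y\<bar>)" using N True by auto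
      also have "\<dots> \<le> (M + N) * exp (- \<alpha> * \<bar>y\<bar>)" using M by (intro mult_right_mono) auto
      finally show ?thesis .
    next
      case False
      have "\<bar>Im (kernel (ray \<tau> y))\<bar> \<le> norm (kernel (ray \<tau> y))"
        by (rule abs_Im_le_cmod)
      also have "\<dots> \<le> M * exp (- \<alpha> * \<bar>y\<bar>)" using M(2)[OF assms, of y] False by auto
      also have "\<dots> \<le> (M + N) * exp (- \<alpha> * \<bar>y\<bar>)" using N by (intro mult_right_mono) auto
      finally show ?thesis .
    qed
    then show "AE y in lborel. norm (Im (kernel (ray \<tau> y))) \<le> norm ((M + N) * exp (- \<alpha> * \<bar>y\<bar>))"
      using M N by (auto simp: abs_mult)
  qed
qed

text \<open>For \<open>\<xi> > 0\<close> and \<open>C = stable_C \<alpha> \<sigma> \<beta>\<close>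
  this is \<open>stable_integrand\<close>; the factor \<open>\<i>\<close> is
  \<open>1 / (- \<i>)\<close>.\<close>

definition half_integrand :: "real \<Rightarrow> complex" where
  "half_integrand \<xi> = \<i> * kernel (of_real (ln \<xi>)) / of_real \<xi>"

lemma set_integrable_half_integrand:
  assumes "\<epsilon> > 0"
  shows "set_integrable lborel {\<epsilon><..} half_integrand"
proof -
  obtain M where M: "M \<ge> 0" "\<And>y \<tau>. 0 \<le> \<tau> \<Longrightarrow> \<tau> \<le> pi / 2 \<Longrightarrow> norm (kernel (ray \<tau> y)) \<le> M * exp (- \<alpha> * y)"
    using kernel_ray_decay by blast
  have "set_integrable lborel {\<epsilon><..} (\<lambda>\<xi>. M * \<xi> powr (- \<alpha> - 1))"
    using set_integrable_powr_Ioi[OF assms \<alpha>(1)] by (intro set_integrable_mult_right) auto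
  then show ?thesis
  proof (rule set_integrable_bound)
    have "continuous_on {\<epsilon><..} half_integrand"
      using assms unfolding half_integrand_def kernel_def by (auto intro!: continuous_intros)
    then show "set_borel_measurable lborel {\<epsilon><..} half_integrand"
      unfolding set_borel_measurable_def by (auto intro!: borel_measurable_continuous_on_indicator)
    have "norm (half_integrand \<xi>) \<le> M * \<xi> powr (- \<alpha> - 1)" if "\<epsilon> < \<xi>" for \<xi>
    proof -
      have "norm (half_integrand \<xi>) = norm (kernel (ray 0 (ln \<xi>))) / \<xi>"
        using assms that by (simp add: half_integrand_def ray_0 norm_mult norm_divide)
      also have "\<dots> \<le> M * exp (- \<alpha> * ln \<xi>) / \<xi>"
        using M(2)[of 0] assms that by (intro divide_right_mono) auto
      also have "\<dots> = M * \<xi> powr (- \<alpha> - 1)"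
        using assms that by (simp add: powr_def exp_diff left_diff_distrib)
      finally show ?thesis .
    qed
    then show "AE \<xi> in lborel. \<xi> \<in> {\<epsilon><..} \<longrightarrow> norm (half_integrand \<xi>) \<le> norm (M * \<xi> powr (- \<alpha> - 1))"
      using M by (auto simp: abs_mult)
  qed
qed

text \<open>Contour rotation with the origin cut off: the difference of values of \<open>G\<close>
  is the contribution of the arc of radius \<epsilon>. On the rotated line \<open>G\<close> tends to
  \<open>L\<close>, hence also on the real line, and there \<open>\<i> * G\<close> composed with
  \<open>ln\<close> is a primitive of \<open>half_integrand\<close>.\<close>

lemma set_integral_half_integrand:
  assumes G: "\<And>z. (G has_field_derivative kernel z) (at z)" and "\<epsilon> > 0"
  shows "set_lebesgue_integral lborel {\<epsilon><..} half_integrand =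
    \<i> * (set_lebesgue_integral lborel {ln \<epsilon><..} (\<lambda>y. kernel (ray (pi / 2) y)) +
         (G (ray (pi / 2) (ln \<epsilon>)) - G (ray 0 (ln \<epsilon>))))"
proof -
  define L where "L = G (ray (pi / 2) (ln \<epsilon>)) +
    set_lebesgue_integral lborel {ln \<epsilon><..} (\<lambda>y. kernel (ray (pi / 2) y))"
  have "((\<lambda>y. G (ray (pi / 2) y)) \<longlongrightarrow> L) at_top"
    unfolding L_def
    by (intro FTC_tendsto_at_top primitive_ray_has_vector_derivative[OF G] continuous_kernel_ray
        set_integrable_kernel_ray) auto
  from tendsto_diff[OF this primitive_rays_at_top[OF G]]
  have "((\<lambda>y. G (ray 0 y)) \<longlongrightarrow> L) at_top" by simp
  then have "((\<lambda>\<xi>. G (ray 0 (ln \<xi>))) \<longlongrightarrow> L) at_top"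
    by (rule filterlim_compose) (rule ln_at_top)
  then have lim: "((\<lambda>\<xi>. \<i> * G (ray 0 (ln \<xi>))) \<longlongrightarrow> \<i> * L) at_top"
    by (intro tendsto_intros)
  have "((\<lambda>\<xi>. \<i> * G (ray 0 (ln \<xi>))) \<longlongrightarrow>
      \<i> * G (ray 0 (ln \<epsilon>)) + set_lebesgue_integral lborel {\<epsilon><..} half_integrand) at_top"
  proof (rule FTC_tendsto_at_top)
    fix \<xi> assume "\<epsilon> \<le> \<xi>"
    then have \<xi>: "\<xi> > 0" using assms by simp
    have "(ln has_vector_derivative 1 / \<xi>) (at \<xi>)"
      using \<xi> DERIV_ln_divide has_real_derivative_iff_has_vector_derivative by blast
    from vector_diff_chain_at[OF this primitive_ray_has_vector_derivative[OF G, of 0]]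
    have "((\<lambda>\<xi>. G (ray 0 (ln \<xi>))) has_vector_derivative (1 / \<xi>) *\<^sub>R kernel (ray 0 (ln \<xi>))) (at \<xi>)"
      by (simp add: o_def)
    from has_vector_derivative_mult_right[OF this, of "\<i>"]
    show "((\<lambda>\<xi>. \<i> * G (ray 0 (ln \<xi>))) has_vector_derivative half_integrand \<xi>) (at \<xi>)"
      by (simp add: half_integrand_def ray_0 scaleR_conv_of_real)
  next
    show "continuous_on {\<epsilon>..} half_integrand"
      using assms unfolding half_integrand_def kernel_def by (auto intro!: continuous_intros)
  qed (rule set_integrable_half_integrand[OF assms(2)])
  from tendsto_unique[OF _ this lim] show ?thesis
    by (simp add: L_def algebra_simps)
qed

text \<open>The factor \<open>\<i>\<close> turns the real part into minus an imaginary part, exactly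
  the part of the kernel integrable on the whole line. Letting \<epsilon> tend to 0 sends
  \<open>ln \<epsilon>\<close> to the left end, where the arc contributes the jump.\<close>

lemma Re_half_integral_tendsto:
  "((\<lambda>\<epsilon>. Re (set_lebesgue_integral lborel {\<epsilon><..} half_integrand)) \<longlongrightarrow>
     sgn x * (pi / 2) - (LINT y|lborel. Im (kernel (ray (pi / 2) y)))) (at_right 0)"
proof -
  obtain G where G: "\<And>z. (G has_field_derivative kernel z) (at z)"
    using kernel_primitive by blast
  let ?I = "\<lambda>a. set_lebesgue_integral lborel {a<..} (\<lambda>y. Im (kernel (ray (pi / 2) y)))"
  let ?D = "\<lambda>a. G (ray (pi / 2) a) - G (ray 0 a)"
  have "(?I \<longlongrightarrow> (LINT y|lborel. Im (kernel (ray (pi / 2) y)))) at_bot"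
    by (intro tendsto_set_integral_Ioi_at_bot integrable_Im_kernel_ray) auto
  then have "((\<lambda>a. - ?I a - Im (?D a)) \<longlongrightarrow>
      - (LINT y|lborel. Im (kernel (ray (pi / 2) y))) - Im (- \<i> * of_real (sgn x * (pi / 2)))) at_bot"
    by (intro tendsto_intros primitive_rays_at_bot G)
  from filterlim_compose[OF this ln_at_0]
  have "((\<lambda>\<epsilon>. - ?I (ln \<epsilon>) - Im (?D (ln \<epsilon>))) \<longlongrightarrow>
      sgn x * (pi / 2) - (LINT y|lborel. Im (kernel (ray (pi / 2) y)))) (at_right 0)"
    by simp
  moreover have "\<forall>\<^sub>F \<epsilon> in at_right 0. - ?I (ln \<epsilon>) - Im (?D (ln \<epsilon>)) =
      Re (set_lebesgue_integral lborel {\<epsilon><..} half_integrand)"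
    using eventually_at_right_less[of "0::real"]
  proof eventually_elim
    case (elim \<epsilon>)
    have "?I (ln \<epsilon>) = Im (set_lebesgue_integral lborel {ln \<epsilon><..} (\<lambda>y. kernel (ray (pi / 2) y)))"
      using integral_Im[OF set_integrable_kernel_ray[unfolded set_integrable_def, of "pi / 2" "ln \<epsilon>"]]
      by (simp add: set_lebesgue_integral_def)
    then show ?case
      unfolding set_integral_half_integrand[OF G elim] by simp
  qed
  ultimately show ?thesis by (rule Lim_transform_eventually)
qed

text \<open>At a quarter turn the term with \<open>x\<close> is real, so the phase comes only from
  \<open>C\<close>, whose polar form is rotated to the angle \<open>\<theta>\<close>.\<close>

lemma Im_kernel_ray_half_pi:
  "Im (kernel (ray (pi / 2) y)) =
    - (exp (- \<bar>x\<bar> * exp y - norm C * cos (Arg C - sgn x * (\<alpha> * pi / 2)) * exp (\<alpha> * y))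
       * sin (norm C * sin (Arg C - sgn x * (\<alpha> * pi / 2)) * exp (\<alpha> * y)))"
proof -
  define \<theta> where "\<theta> = Arg C - sgn x * (\<alpha> * pi / 2)"
  have "C * exp (of_real \<alpha> * ray (pi / 2) y) = of_real (norm C * exp (\<alpha> * y)) * cis \<theta>"
  proof -
    have "C = of_real (norm C) * cis (Arg C)"
      by (metis rcis_cmod_Arg rcis_def)
    then have "C * exp (of_real \<alpha> * ray (pi / 2) y) =
        (of_real (norm C) * cis (Arg C)) * (of_real (exp (\<alpha> * y)) * cis (- sgn x * (\<alpha> * (pi / 2))))"
      by (simp only: kernel_exponent_ray)
    also have "\<dots> = of_real (norm C * exp (\<alpha> * y)) * (cis (Arg C) * cis (- sgn x * (\<alpha> * (pi / 2))))"
      by simp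
    finally show ?thesis by (simp add: cis_mult \<theta>_def)
  qed
  then have "kernel (ray (pi / 2) y) = exp (- of_real (\<bar>x\<bar> * exp y) - of_real (norm C * exp (\<alpha> * y)) * cis \<theta>)"
    unfolding kernel_def kernel_exponent_ray(1) by simp
  then show ?thesis
    unfolding \<theta>_def[symmetric] by (simp add: Im_exp mult_ac)
qed

end

section \<open>Hermitian symmetry and the principal value\<close>

lemma set_integral_symmetric_hermitian:
  fixes f :: "real \<Rightarrow> complex"
  assumes f: "\<And>\<xi>. f (- \<xi>) = cnj (f \<xi>)"
    and int: "set_integrable lborel {\<epsilon><..} f" and "\<epsilon> > 0"
  shows "set_integrable lborel {\<xi>. \<bar>\<xi>\<bar> > \<epsilon>} f"
    and "set_lebesgue_integral lborel {\<xi>. \<bar>\<xi>\<bar> > \<epsilon>} f =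
      of_real (2 * Re (set_lebesgue_integral lborel {\<epsilon><..} f))"
proof -
  have split: "{\<xi>. \<bar>\<xi>\<bar> > \<epsilon>} = {\<epsilon><..} \<union> {..< - \<epsilon>}"
    using \<open>\<epsilon> > 0\<close> by auto
  \<comment> \<open>The shape \<open>0 + (- 1) * \<xi>\<close> is that of the affine substitution
    rules applied below.\<close>
  have flip: "indicat_real {..< - \<epsilon>} \<xi> *\<^sub>R f \<xi> =
      cnj (indicat_real {\<epsilon><..} (0 + (- 1) * \<xi>) *\<^sub>R f (0 + (- 1) * \<xi>))" for \<xi>
    by (auto simp: indicator_def f)
  have int': "set_integrable lborel {..< - \<epsilon>} f"
    unfolding set_integrable_def flip
    using int[unfolded set_integrable_def] by (intro integrable_cnj lborel_integrable_real_affine) auto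
  show "set_integrable lborel {\<xi>. \<bar>\<xi>\<bar> > \<epsilon>} f"
    unfolding split by (intro set_integrable_Un int int') auto
  have "set_lebesgue_integral lborel {..< - \<epsilon>} f =
      cnj (LINT \<xi>|lborel. indicat_real {\<epsilon><..} (0 + (- 1) * \<xi>) *\<^sub>R f (0 + (- 1) * \<xi>))"
    unfolding set_lebesgue_integral_def flip by (rule Bochner_Integration.integral_cnj)
  also have "\<dots> = cnj (set_lebesgue_integral lborel {\<epsilon><..} f)"
    unfolding set_lebesgue_integral_def
    by (subst lborel_integral_real_affine[where c = "- 1" and t = 0]) simp_all
  finally have "set_lebesgue_integral lborel {..< - \<epsilon>} f = cnj (set_lebesgue_integral lborel {\<epsilon><..} f)" .
  moreover have "set_lebesgue_integral lborel ({\<epsilon><..} \<union> {..< - \<epsilon>}) f =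
      set_lebesgue_integral lborel {\<epsilon><..} f + set_lebesgue_integral lborel {..< - \<epsilon>} f"
    using \<open>\<epsilon> > 0\<close> by (intro set_integral_Un int int') auto
  ultimately show "set_lebesgue_integral lborel {\<xi>. \<bar>\<xi>\<bar> > \<epsilon>} f =
      of_real (2 * Re (set_lebesgue_integral lborel {\<epsilon><..} f))"
    unfolding split by (simp add: complex_eq_iff)
qed

text \<open>Reflection conjugates both the exponent and the denominator. At the origin both sides
  are 0, by division by zero.\<close>

lemma stable_integrand_minus:
  "stable_integrand \<alpha> \<sigma> \<beta> x (- \<xi>) = cnj (stable_integrand \<alpha> \<sigma> \<beta> x \<xi>)"
  by (simp add: stable_integrand_def stable_psi_def exp_cnj sgn_minus)

text \<open>Both signs of \<open>x\<close> are treated at once through \<open>sgn x\<close>. As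
  \<open>Lim\<close> and the Lebesgue integral are total, the first two conclusions are what give
  the formula its meaning.\<close>

theorem stable_cdf_rotated:
  fixes \<alpha> \<sigma> \<beta> x :: real
  assumes "0 < \<alpha>" "\<alpha> < 1" "\<sigma> > 0" "x \<noteq> 0"
  defines "C \<equiv> stable_C \<alpha> \<sigma> \<beta>"
  defines "h \<equiv> \<lambda>y. exp (- \<bar>x\<bar> * exp y - norm C * cos (Arg C - sgn x * (\<alpha> * pi / 2)) * exp (\<alpha> * y))
                * sin (norm C * sin (Arg C - sgn x * (\<alpha> * pi / 2)) * exp (\<alpha> * y))"
  shows "pv_integrable (stable_integrand \<alpha> \<sigma> \<beta> x)"
    and "integrable lborel h"
    and "stable_cdf \<alpha> \<sigma> \<beta> x = of_real ((1 + sgn x) / 2 + 1 / pi * (LINT y|lborel. h y))"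
proof -
  \<comment> \<open>The real part of \<open>stable_C \<alpha> \<sigma> \<beta>\<close> is
    \<open>\<sigma> powr \<alpha>\<close>, hence positive.\<close>
  interpret rotated_stable_kernel \<alpha> x C
    using assms by unfold_locales (auto simp: C_def stable_C_def)
  have h: "h y = - Im (kernel (ray (pi / 2) y))" for y
    unfolding h_def Im_kernel_ray_half_pi by simp
  show "integrable lborel h"
    unfolding h using integrable_Im_kernel_ray[of "pi / 2"] by simp
  have half: "stable_integrand \<alpha> \<sigma> \<beta> x \<xi> = half_integrand \<xi>" if "\<xi> > 0" for \<xi>
  proof -
    have "exp (complex_of_real (ln \<xi>)) = of_real \<xi>"
      and "exp (complex_of_real \<alpha> * of_real (ln \<xi>)) = of_real (\<xi> powr \<alpha>)"
      using that by (simp_all add: powr_def exp_of_real flip: of_real_mult)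
    then show ?thesis
      using that by (simp add: stable_integrand_def half_integrand_def kernel_def stable_psi_pos
          C_def[symmetric] field_simps)
  qed
  have int: "set_integrable lborel {\<epsilon><..} (stable_integrand \<alpha> \<sigma> \<beta> x)" if "\<epsilon> > 0" for \<epsilon>
    using set_integrable_half_integrand[OF that]
    by (rule set_integrable_cong[THEN iffD1, rotated -1]) (use that half in auto)
  have integral: "set_lebesgue_integral lborel {\<epsilon><..} (stable_integrand \<alpha> \<sigma> \<beta> x) =
      set_lebesgue_integral lborel {\<epsilon><..} half_integrand" if "\<epsilon> > 0" for \<epsilon>
    by (rule set_lebesgue_integral_cong) (use that half in auto)
  \<comment> \<open>Twice the limit of the real part over the half-line; \<open>h\<close> is minus
    the imaginary part of the kernel, whence the plus sign.\<close>
  define l where "l = 2 * (sgn x * (pi / 2) + (LINT y|lborel. h y))"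
  have "((\<lambda>\<epsilon>. complex_of_real (2 * Re (set_lebesgue_integral lborel {\<epsilon><..} half_integrand)))
      \<longlongrightarrow> of_real (2 * (sgn x * (pi / 2) - (LINT y|lborel. Im (kernel (ray (pi / 2) y)))))) (at_right 0)"
    by (intro tendsto_intros Re_half_integral_tendsto)
  then have "((\<lambda>\<epsilon>. complex_of_real (2 * Re (set_lebesgue_integral lborel {\<epsilon><..} half_integrand)))
      \<longlongrightarrow> of_real l) (at_right 0)"
    by (simp add: l_def h)
  moreover have "\<forall>\<^sub>F \<epsilon> in at_right 0. complex_of_real (2 * Re (set_lebesgue_integral lborel {\<epsilon><..} half_integrand)) =
      set_lebesgue_integral lborel {\<xi>. \<bar>\<xi>\<bar> > \<epsilon>} (stable_integrand \<alpha> \<sigma> \<beta> x)"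
    using eventually_at_right_less[of "0::real"]
  proof eventually_elim
    case (elim \<epsilon>)
    show ?case
      using set_integral_symmetric_hermitian(2)[OF stable_integrand_minus int[OF elim] elim]
      by (simp add: integral[OF elim])
  qed
  ultimately have lim: "((\<lambda>\<epsilon>. set_lebesgue_integral lborel {\<xi>. \<bar>\<xi>\<bar> > \<epsilon>} (stable_integrand \<alpha> \<sigma> \<beta> x))
      \<longlongrightarrow> of_real l) (at_right 0)"
    by (rule Lim_transform_eventually)
  show "pv_integrable (stable_integrand \<alpha> \<sigma> \<beta> x)"
    unfolding pv_integrable_def
    using lim set_integral_symmetric_hermitian(1)[OF stable_integrand_minus int] by blast
  have "pv_integral (stable_integrand \<alpha> \<sigma> \<beta> x) = of_real l"
    unfolding pv_integral_def by (rule tendsto_Lim[OF _ lim]) simp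
  then show "stable_cdf \<alpha> \<sigma> \<beta> x = of_real ((1 + sgn x) / 2 + 1 / pi * (LINT y|lborel. h y))"
    by (simp add: stable_cdf_def l_def add_divide_distrib distrib_left)
qed

text \<open>The two sign cases are the values 1 and -1 of \<open>sgn x'\<close> in
  \<open>stable_cdf_rotated\<close>.\<close>

theorem mainTheorem2:
  fixes \<alpha> \<sigma> \<beta> x' \<phi>\<^sub>0 :: real and C :: complex
  assumes "0 < \<alpha>" "\<alpha> < 1" "\<sigma> > 0" "- 1 \<le> \<beta>" "\<beta> \<le> 1"
    and C: "C = stable_C \<alpha> \<sigma> \<beta>"
    and phi: "\<phi>\<^sub>0 = Arg C"
    and "x' \<noteq> 0"
    and "\<bar>x'\<bar> + cmod C * cos (\<phi>\<^sub>0 - sgn x' * (\<alpha> * pi / 2)) > 0"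
  shows "pv_integrable (stable_integrand \<alpha> \<sigma> \<beta> x') \<and>
    (x' > 0 \<longrightarrow>
      integrable lborel (\<lambda>y. exp (- \<bar>x'\<bar> * exp y - cmod C * cos (\<phi>\<^sub>0 - \<alpha> * pi / 2) * exp (\<alpha> * y))
                                * sin (cmod C * sin (\<phi>\<^sub>0 - \<alpha> * pi / 2) * exp (\<alpha> * y))) \<and>
      stable_cdf \<alpha> \<sigma> \<beta> x' = of_real ((1 + 1) / 2 + 1 / pi *
        (LINT y|lborel. exp (- \<bar>x'\<bar> * exp y - cmod C * cos (\<phi>\<^sub>0 - \<alpha> * pi / 2) * exp (\<alpha> * y))
                          * sin (cmod C * sin (\<phi>\<^sub>0 - \<alpha> * pi / 2) * exp (\<alpha> * y))))) \<and>
    (x' < 0 \<longrightarrow>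
      integrable lborel (\<lambda>y. exp (- \<bar>x'\<bar> * exp y - cmod C * cos (\<phi>\<^sub>0 + \<alpha> * pi / 2) * exp (\<alpha> * y))
                                * sin (cmod C * sin (\<phi>\<^sub>0 + \<alpha> * pi / 2) * exp (\<alpha> * y))) \<and>
      stable_cdf \<alpha> \<sigma> \<beta> x' = of_real ((1 - 1) / 2 + 1 / pi *
        (LINT y|lborel. exp (- \<bar>x'\<bar> * exp y - cmod C * cos (\<phi>\<^sub>0 + \<alpha> * pi / 2) * exp (\<alpha> * y))
                          * sin (cmod C * sin (\<phi>\<^sub>0 + \<alpha> * pi / 2) * exp (\<alpha> * y)))))"
  using stable_cdf_rotated[OF assms(1-3) \<open>x' \<noteq> 0\<close>, of \<beta>]
  unfolding C[symmetric] phi[symmetric] by auto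

end
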